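(* Let $\kappa<\lambda$ be regular uncountable cardinals and suppose there is a $\square(\lambda,<\kappa)$-sequence that is not full. Then $\mathrm{Refl}(2,\lambda)$ fails, i.e., there are two stationary subsets of $\lambda$ that do not reflect simultaneously.
   Context: For a set of ordinals $A$, $\mathrm{acc}(A)$ is the set of $\beta<\sup\{\alpha+1\mid\alpha\in A\}$ with $\beta=\sup(A\cap\beta)$. A coherent sequence of length $\lambda$ and width $<\eta$ is $\mathcal{C}=\langle\mathcal{C}_\alpha\mid\alpha<\lambda\rangle$ where each $\mathcal{C}_\alpha$ is a nonempty set of fewer than $\eta$ closed unbounded subsets of $\alpha$ (for successor $\alpha=\beta+1$, $\mathcal{C}_\alpha=\{\{\beta\}\}$), such that for all $\beta<\lambda$, $C\in\mathcal{C}_\beta$ and $\alpha\in\mathrm{acc}(C)$, $C\cap\alpha\in\mathcal{C}_\alpha$. A thread is a club $D\subseteq\lambda$ with $D\cap\alpha\in\mathcal{C}_\alpha$ for all $\alpha\in\mathrm{acc}(D)$. A $\square(\lambda,<\eta)$-sequence is a coherent sequence of length $\lambda$ and width $<\eta$ with no thread. For a coherent sequence $\mathcal{C}$, let $A_{\mathcal{C}}$ be the set of $\alpha<\lambda$ for which there is a club $D_\alpha\subseteq\lambda$ such that for every $\beta\in D_\alpha$, $\alpha\in\bigcup_{C\in\mathcal{C}_\beta}\mathrm{acc}(C)$; $\mathcal{C}$ is full if $A_{\mathcal{C}}$ is unbounded in $\lambda$. A stationary $S\subseteq\lambda$ reflects at $\alpha<\lambda$ if $\mathrm{cf}(\alpha)>\omega$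 and $S\cap\alpha$ is stationary in $\alpha$; two stationary sets reflect simultaneously if both reflect at a common $\alpha<\lambda$. *)

theory Defs
  imports Main "HOL-Library.Countable_Set"
begin

text \<open>Ordinals below lambda are modelled as the elements of the field of a
cardinal well-order r (so lambda is the order type of r).  For a in Field r,
the ordinal a is identified with the set of its predecessors underS r a.
Strict order: lt r x y.\<close>

definition lt :: "'a rel \<Rightarrow> 'a \<Rightarrow> 'a \<Rightarrow> bool" where
  "lt r x y \<longleftrightarrow> (x, y) \<in> r \<and> x \<noteq> y"

text \<open>acc(A): beta < sup{alpha+1 | alpha in A} and beta = sup(A \<inter> beta), beta > 0
  (the degenerate point 0 = sup of the empty set is excluded, as intended).\<close>
definition acc :: "'a rel \<Rightarrow> 'a set \<Rightarrow> 'a set" where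
  "acc r A = {b \<in> Field r. (\<exists>a\<in>A. (b, a) \<in> r) \<and> (\<exists>g. lt r g b) \<and>
       (\<forall>g. lt r g b \<longrightarrow> (\<exists>d\<in>A. lt r g d \<and> lt r d b))}"

definition club_in :: "'a rel \<Rightarrow> 'a \<Rightarrow> 'a set \<Rightarrow> bool" where
  "club_in r a C \<longleftrightarrow> C \<subseteq> underS r a \<and>
     (\<forall>b\<in>underS r a. \<exists>c\<in>C. (b, c) \<in> r) \<and>
     (\<forall>b\<in>underS r a. b \<in> acc r C \<longrightarrow> b \<in> C)"

definition club :: "'a rel \<Rightarrow> 'a set \<Rightarrow> bool" where
  "club r C \<longleftrightarrow> C \<subseteq> Field r \<and>
     (\<forall>b\<in>Field r. \<exists>c\<in>C. (b, c) \<in> r) \<and>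
     (\<forall>b\<in>Field r. b \<in> acc r C \<longrightarrow> b \<in> C)"

definition stationary :: "'a rel \<Rightarrow> 'a set \<Rightarrow> bool" where
  "stationary r S \<longleftrightarrow> S \<subseteq> Field r \<and> (\<forall>C. club r C \<longrightarrow> S \<inter> C \<noteq> {})"

definition stationary_in :: "'a rel \<Rightarrow> 'a \<Rightarrow> 'a set \<Rightarrow> bool" where
  "stationary_in r a S \<longleftrightarrow> S \<subseteq> underS r a \<and> (\<forall>C. club_in r a C \<longrightarrow> S \<inter> C \<noteq> {})"

text \<open>cf(a) > omega: no countable subset of a is cofinal in a
  (this excludes 0, successors and limits of countable cofinality).\<close>
definition uncountable_cof :: "'a rel \<Rightarrow> 'a \<Rightarrow> bool" where
  "uncountable_cof r a \<longleftrightarrow> a \<in> Field r \<and>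
     (\<forall>X \<subseteq> underS r a. countable X \<longrightarrow> (\<exists>g\<in>underS r a. \<forall>x\<in>X. lt r x g))"

definition is_succ_of :: "'a rel \<Rightarrow> 'a \<Rightarrow> 'a \<Rightarrow> bool" where
  "is_succ_of r a b \<longleftrightarrow> lt r b a \<and> \<not> (\<exists>g. lt r b g \<and> lt r g a)"

definition coherent_seq :: "'a rel \<Rightarrow> 'b rel \<Rightarrow> ('a \<Rightarrow> 'a set set) \<Rightarrow> bool" where
  "coherent_seq r kappa \<C> \<longleftrightarrow>
     (\<forall>a\<in>Field r. \<C> a \<noteq> {} \<and> (card_of (\<C> a), kappa) \<in> ordLess \<and> (\<forall>C\<in>\<C> a. club_in r a C)) \<and>
     (\<forall>a\<in>Field r. \<forall>b. is_succ_of r a b \<longrightarrow> \<C> a = {{b}}) \<and>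
     (\<forall>b\<in>Field r. \<forall>C\<in>\<C> b. \<forall>a\<in>acc r C. C \<inter> underS r a \<in> \<C> a)"

definition is_thread :: "'a rel \<Rightarrow> ('a \<Rightarrow> 'a set set) \<Rightarrow> 'a set \<Rightarrow> bool" where
  "is_thread r \<C> D \<longleftrightarrow> club r D \<and> (\<forall>a\<in>acc r D. D \<inter> underS r a \<in> \<C> a)"

definition square_seq :: "'a rel \<Rightarrow> 'b rel \<Rightarrow> ('a \<Rightarrow> 'a set set) \<Rightarrow> bool" where
  "square_seq r kappa \<C> \<longleftrightarrow> coherent_seq r kappa \<C> \<and> \<not> (\<exists>D. is_thread r \<C> D)"

definition A_set :: "'a rel \<Rightarrow> ('a \<Rightarrow> 'a set set) \<Rightarrow> 'a set" where
  "A_set r \<C> = {a \<in> Field r. \<exists>D. club r D \<and>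
        (\<forall>b\<in>D. a \<in> (\<Union>C\<in>\<C> b. acc r C))}"

definition full :: "'a rel \<Rightarrow> ('a \<Rightarrow> 'a set set) \<Rightarrow> bool" where
  "full r \<C> \<longleftrightarrow> (\<forall>b\<in>Field r. \<exists>a\<in>A_set r \<C>. lt r b a)"

definition reflects_at :: "'a rel \<Rightarrow> 'a set \<Rightarrow> 'a \<Rightarrow> bool" where
  "reflects_at r S a \<longleftrightarrow> uncountable_cof r a \<and> stationary_in r a (S \<inter> underS r a)"

end

theory Submission
  imports Defs
begin

text \<open>
  Fix a bound for the set \<open>A\<close> of the sequence.  For \<open>\<alpha>\<close> above that bound, the set \<open>S\<close> of all \<open>\<beta>\<close>
  such that \<open>\<alpha>\<close> is an accumulation point of no member of \<open>\<C> \<beta>\<close> is stationary.  If \<open>\<beta>\<close> has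
  cofinality at least \<open>\<kappa>\<close>, the fewer than \<open>\<kappa>\<close> many clubs in \<open>\<C> \<beta>\<close> have a common accumulation
  point above the bound; pressing down yields one \<open>\<alpha>\<close> for which the set \<open>T\<close> of all \<open>\<beta>\<close> such that
  \<open>\<alpha>\<close> is an accumulation point of every member of \<open>\<C> \<beta>\<close> is stationary.  If \<open>S\<close> and \<open>T\<close> both
  reflected at \<open>\<delta>\<close>, then for \<open>C \<in> \<C> \<delta>\<close> both would meet the club \<open>acc C\<close> above \<open>\<alpha>\<close>, and coherence
  would give \<open>\<alpha> \<notin> acc C\<close> as well as \<open>\<alpha> \<in> acc C\<close>.
\<close>

unbundle cardinal_syntax

section \<open>Order facts in a well-order\<close>

locale well_order_rel =
  fixes r :: "'a rel"
  assumes well_order: "Well_order r"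
begin

lemma wo_rel: "wo_rel r"
  using well_order by (simp add: wo_rel_def)

lemmas TRANS = wo_rel.TRANS[OF wo_rel]
  and ANTISYM = wo_rel.ANTISYM[OF wo_rel]
  and TOTALS = wo_rel.TOTALS[OF wo_rel]
  and REFL = wo_rel.REFL[OF wo_rel]

lemma lt_Field: "lt r x y \<Longrightarrow> x \<in> Field r" "lt r x y \<Longrightarrow> y \<in> Field r"
  by (auto simp: lt_def Field_def)

lemma underS_iff_lt: "x \<in> underS r y \<longleftrightarrow> lt r x y"
  by (auto simp: lt_def underS_def)

lemma lt_irrefl: "\<not> lt r x x"
  by (simp add: lt_def)

lemma lt_trans: "lt r x y \<Longrightarrow> lt r y z \<Longrightarrow> lt r x z"
  using TRANS ANTISYM unfolding lt_def trans_def antisym_def by blast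

lemma le_lt_trans: "(x, y) \<in> r \<Longrightarrow> lt r y z \<Longrightarrow> lt r x z"
  using TRANS ANTISYM unfolding lt_def trans_def antisym_def by blast

lemma lt_le_trans: "lt r x y \<Longrightarrow> (y, z) \<in> r \<Longrightarrow> lt r x z"
  using TRANS ANTISYM unfolding lt_def trans_def antisym_def by blast

lemma not_lt_iff_le: "x \<in> Field r \<Longrightarrow> y \<in> Field r \<Longrightarrow> \<not> lt r x y \<longleftrightarrow> (y, x) \<in> r"
  using TOTALS REFL ANTISYM unfolding lt_def refl_on_def antisym_def by blast

lemma le_refl: "x \<in> Field r \<Longrightarrow> (x, x) \<in> r"
  using REFL unfolding refl_on_def by blast

lemma accI:
  assumes "lt r g b" "c \<in> A" "(b, c) \<in> r" "\<And>g. lt r g b \<Longrightarrow> \<exists>d\<in>A. lt r g d \<and> lt r d b"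
  shows "b \<in> acc r A"
  unfolding acc_def using assms lt_Field by blast

text \<open>Take the minimum of the set of strict upper bounds. If \<open>X\<close> has no largest
  element, this is its supremum, and the last property makes it a limit of \<open>X\<close>.\<close>

lemma ex_least_strict_upper_bound:
  assumes "b \<in> Field r" "\<forall>x\<in>X. lt r x b"
  obtains s where "s \<in> Field r" "(s, b) \<in> r" "\<forall>x\<in>X. lt r x s"
    "\<And>y. lt r y s \<Longrightarrow> \<exists>x\<in>X. (y, x) \<in> r"
proof -
  define B where "B = {b \<in> Field r. \<forall>x\<in>X. lt r x b}"
  have B: "B \<subseteq> Field r" "B \<noteq> {}" "b \<in> B" using assms by (auto simp: B_def)
  let ?s = "wo_rel.minim r B"
  have s: "?s \<in> B" "\<And>c. c \<in> B \<Longrightarrow> (?s, c) \<in> r"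
    using wo_rel.minim_in[OF wo_rel B(1,2)] wo_rel.minim_least[OF wo_rel B(1)] by auto
  have "\<exists>x\<in>X. (y, x) \<in> r" if y: "lt r y ?s" for y
  proof (rule ccontr)
    assume "\<not> ?thesis"
    then have "\<forall>x\<in>X. lt r x y"
      using not_lt_iff_le lt_Field(1)[OF y] assms(2) lt_Field(1) by metis
    then have "y \<in> B" using lt_Field(1)[OF y] by (simp add: B_def)
    from lt_le_trans[OF y s(2)[OF this]] show False by (simp add: lt_irrefl)
  qed
  then show ?thesis using that[of ?s] s B(3) by (auto simp: B_def)
qed

section \<open>Accumulation points of clubs\<close>

text \<open>Starting from \<open>g\<close>, choose \<omega> many points below \<delta> such that
  every member of \<open>F\<close> has an element between consecutive ones; their supremum is a
  limit of every member. Hypothesis \<open>bnd\<close> stands for a cofinality exceeding the size of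
  \<open>F\<close>, so that one proof covers both a single club and a whole family
  \<open>\<C> b\<close>.\<close>

lemma common_acc_point:
  assumes \<delta>: "uncountable_cof r \<delta>" and C: "\<And>C. C \<in> F \<Longrightarrow> club_in r \<delta> C"
    and bnd: "\<And>f. (\<And>C. C \<in> F \<Longrightarrow> lt r (f C) \<delta>) \<Longrightarrow> \<exists>g. lt r g \<delta> \<and> (\<forall>C\<in>F. lt r (f C) g)"
    and g: "lt r g \<delta>"
  obtains a where "lt r g a" "lt r a \<delta>" "\<And>C. C \<in> F \<Longrightarrow> a \<in> acc r C"
proof -
  have cnt: "\<exists>g. lt r g \<delta> \<and> (\<forall>x\<in>X. lt r x g)" if "countable X" "\<forall>x\<in>X. lt r x \<delta>" for X
    using \<delta> that unfolding uncountable_cof_def by (metis underS_iff_lt subsetI)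
  have up: "\<exists>y. lt r x y \<and> lt r y \<delta>" if "lt r x \<delta>" for x
    using cnt[of "{x}"] that by auto
  have next_C: "\<exists>c\<in>C. lt r x c \<and> lt r c \<delta>" if x: "lt r x \<delta>" and CF: "C \<in> F" for x C
  proof -
    obtain y where y: "lt r x y" "lt r y \<delta>" using up[OF x] by blast
    with C[OF CF] obtain c where "c \<in> C" "(y, c) \<in> r" "lt r c \<delta>"
      unfolding club_in_def by (metis underS_iff_lt subsetD)
    with y show ?thesis using lt_le_trans by blast
  qed
  have "\<exists>y. lt r x y \<and> lt r y \<delta> \<and> (\<forall>C\<in>F. \<exists>c\<in>C. lt r x c \<and> lt r c y)" if x: "lt r x \<delta>" for x
  proof -
    obtain f where f: "\<And>C. C \<in> F \<Longrightarrow> f C \<in> C \<and> lt r x (f C) \<and> lt r (f C) \<delta>"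
      using next_C[OF x] by metis
    then obtain y where y: "lt r y \<delta>" "\<forall>C\<in>F. lt r (f C) y" using bnd[of f] by blast
    \<comment> \<open>If \<open>F\<close> is empty, \<open>y\<close> need not exceed
      \<open>x\<close>; hence a further bound above both.\<close>
    obtain z where z: "lt r z \<delta>" "\<forall>w\<in>{x, y}. lt r w z" using cnt[of "{x, y}"] x y by auto
    then have "lt r x z" "lt r y z" by auto
    then show ?thesis using f y z(1) lt_trans by meson
  qed
  then obtain N where N: "\<And>x. lt r x \<delta> \<Longrightarrow>
      lt r x (N x) \<and> lt r (N x) \<delta> \<and> (\<forall>C\<in>F. \<exists>c\<in>C. lt r x c \<and> lt r c (N x))"
    by metis
  define s where "s n = (N ^^ n) g" for n
  have s: "lt r (s n) \<delta>" for n
    by (induction n) (use g N in \<open>auto simp: s_def\<close>)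
  have s_step: "lt r (s n) (s (Suc n))" "C \<in> F \<Longrightarrow> \<exists>c\<in>C. lt r (s n) c \<and> lt r c (s (Suc n))" for n C
    using N[OF s[of n]] by (auto simp: s_def)
  obtain b where b: "lt r b \<delta>" "\<forall>x\<in>range s. lt r x b"
    using cnt[of "range s"] s by auto
  obtain a where a: "a \<in> Field r" "(a, b) \<in> r" "\<forall>x\<in>range s. lt r x a"
    "\<And>y. lt r y a \<Longrightarrow> \<exists>x\<in>range s. (y, x) \<in> r"
    using ex_least_strict_upper_bound[OF lt_Field(1)[OF b(1)] b(2)] by metis
  have a\<delta>: "lt r a \<delta>" using a(2) b(1) by (rule le_lt_trans)
  have "s 0 = g" by (simp add: s_def)
  then have ga: "lt r g a" using a(3) by (metis rangeI)
  have "a \<in> acc r C" if CF: "C \<in> F" for C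
  proof -
    have "\<exists>d\<in>C. lt r y d \<and> lt r d a" if y: "lt r y a" for y
    proof -
      obtain n where "(y, s n) \<in> r" using a(4)[OF y] by blast
      then show ?thesis using s_step(2)[OF CF, of n] a(3) le_lt_trans lt_trans by (metis rangeI)
    qed
    moreover have "\<exists>c\<in>C. (a, c) \<in> r"
      using next_C[OF a\<delta> CF] by (auto simp: lt_def)
    ultimately show ?thesis using accI ga by metis
  qed
  then show ?thesis using that ga a\<delta> by blast
qed

text \<open>Unboundedness is \<open>common_acc_point\<close> for the single club \<open>C\<close>;
  closure holds because a limit of limits of \<open>C\<close> is again a limit of
  \<open>C\<close>.\<close>

lemma club_in_acc_above:
  assumes \<delta>: "uncountable_cof r \<delta>" and C: "club_in r \<delta> C" and \<alpha>: "lt r \<alpha> \<delta>"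
  shows "club_in r \<delta> {b \<in> acc r C. lt r \<alpha> b \<and> lt r b \<delta>}" (is "club_in r \<delta> ?E")
  unfolding club_in_def underS_iff_lt
proof (intro conjI ballI impI)
  show "?E \<subseteq> underS r \<delta>" using underS_iff_lt by blast
next
  fix b assume "b \<in> underS r \<delta>"
  then have b: "lt r b \<delta>" by (simp add: underS_iff_lt)
  have cnt: "\<exists>g. lt r g \<delta> \<and> (\<forall>x\<in>X. lt r x g)" if "countable X" "\<forall>x\<in>X. lt r x \<delta>" for X
    using \<delta> that unfolding uncountable_cof_def by (metis underS_iff_lt subsetI)
  obtain g where g: "lt r g \<delta>" "\<forall>x\<in>{b, \<alpha>}. lt r x g" using cnt[of "{b, \<alpha>}"] b \<alpha> by auto
  have "\<exists>g. lt r g \<delta> \<and> (\<forall>D\<in>{C}. lt r (f D) g)"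
    if "\<And>D. D \<in> {C} \<Longrightarrow> lt r (f D) \<delta>" for f
    using cnt[of "{f C}"] that by simp
  then obtain a where a: "lt r g a" "lt r a \<delta>" "a \<in> acc r C"
    using common_acc_point[of \<delta> "{C}" g, OF \<delta> _ _ g(1)] C by (metis singletonD singletonI)
  moreover have "lt r \<alpha> a" "lt r b a" using g(2) a(1) lt_trans by blast+
  ultimately show "\<exists>c\<in>?E. (b, c) \<in> r" by (auto simp: lt_def)
next
  fix b assume "b \<in> underS r \<delta>" and b: "b \<in> acc r ?E"
  then have b\<delta>: "lt r b \<delta>" by (simp add: underS_iff_lt)
  have gb: "\<exists>g. lt r g b" and dE: "\<And>g. lt r g b \<Longrightarrow> \<exists>d\<in>?E. lt r g d \<and> lt r d b"
    using b unfolding acc_def by blast+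
  have "\<exists>c\<in>C. lt r g c \<and> lt r c b" if g: "lt r g b" for g
  proof -
    obtain d where d: "d \<in> acc r C" "lt r g d" "lt r d b" using dE[OF g] by blast
    then obtain c where "c \<in> C" "lt r g c" "lt r c d" unfolding acc_def by blast
    then show ?thesis using d lt_trans by blast
  qed
  moreover have "\<exists>c\<in>C. (b, c) \<in> r"
    using C \<open>b \<in> underS r \<delta>\<close> unfolding club_in_def by blast
  moreover obtain d where "d \<in> ?E" "lt r d b" using gb dE by metis
  then have "lt r \<alpha> b" using lt_trans by blast
  ultimately have "b \<in> acc r C" using accI gb by metis
  then show "b \<in> ?E" using \<open>lt r \<alpha> b\<close> b\<delta> by simp
qed

text \<open>Being a limit concerns only elements below \<open>a\<close>, apart from the required
  element of \<open>C\<close> at or above \<open>a\<close>. Truncation at \<open>b\<close> keeps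
  such an element because \<open>b\<close> is itself a limit of \<open>C\<close>.\<close>

lemma acc_Int_underS:
  assumes b: "b \<in> acc r C" and ab: "lt r a b"
  shows "a \<in> acc r (C \<inter> underS r b) \<longleftrightarrow> a \<in> acc r C"
proof
  assume "a \<in> acc r (C \<inter> underS r b)"
  then have "\<exists>g. lt r g a" "\<exists>c\<in>C. (a, c) \<in> r"
    "\<And>g. lt r g a \<Longrightarrow> \<exists>d\<in>C. lt r g d \<and> lt r d a"
    by (simp_all add: acc_def) blast+
  then show "a \<in> acc r C" using accI by metis
next
  assume a: "a \<in> acc r C"
  obtain c where "c \<in> C" "lt r a c" "lt r c b" using b ab unfolding acc_def by blast
  then have c: "c \<in> C \<inter> underS r b" "(a, c) \<in> r" by (auto simp: underS_def lt_def)
  obtain g where g: "lt r g a" using a by (auto simp: acc_def)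
  show "a \<in> acc r (C \<inter> underS r b)"
  proof (rule accI[OF g c])
    fix g assume "lt r g a"
    then obtain d where "d \<in> C" "lt r g d" "lt r d a" using a unfolding acc_def by blast
    moreover from this have "lt r d b" using ab lt_trans by blast
    ultimately show "\<exists>d\<in>C \<inter> underS r b. lt r g d \<and> lt r d a" using underS_iff_lt by blast
  qed
qed

end

section \<open>Regular cardinals and closure points\<close>

text \<open>Regularity only says that \<open>K\<close> is not cofinal, which gives a weak bound; an
  infinite cardinal has no largest element, so some larger element is a strict bound.\<close>

lemma regularCard_strict_bound:
  assumes r: "Card_order r" "regularCard r" "infinite (Field r)"
    and K: "K \<subseteq> Field r" "|K| <o r"
  obtains b where "b \<in> Field r" "\<forall>k\<in>K. lt r k b"
proof -
  interpret well_order_rel r using r(1) by (simp add: well_order_rel_def card_order_on_def)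
  have "\<not> cofinal K r"
    using r(2) K unfolding regularCard_def by (meson not_ordLess_ordIso)
  then obtain a where a: "a \<in> Field r" "\<And>k. k \<in> K \<Longrightarrow> \<not> lt r a k"
    unfolding cofinal_def lt_def by blast
  obtain b where b: "b \<in> Field r" "lt r a b"
    using infinite_Card_order_limit[OF r(1,3) a(1)] by (auto simp: lt_def)
  have "lt r k b" if "k \<in> K" for k
    using a not_lt_iff_le le_lt_trans b(2) K(1) that by blast
  then show ?thesis using that b by blast
qed

text \<open>The closure point is the supremum of a \<open>kappa\<close>-sequence iterating \<open>h\<close>.\<close>

lemma closure_point_of_large_cofinality:
  fixes r :: "'a rel" and kappa :: "'b rel"
  assumes r: "Card_order r" "regularCard r" "infinite (Field r)"
    and k: "Card_order kappa" "regularCard kappa" "infinite (Field kappa)"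
    and kr: "kappa <o r"
    and h: "\<And>x. x \<in> Field r \<Longrightarrow> h x \<in> Field r"
    and g: "g \<in> Field r"
  obtains b where "lt r g b"
    "\<forall>x. lt r x b \<longrightarrow> (\<exists>y. (x, y) \<in> r \<and> lt r y b \<and> lt r (h y) b)"
    "\<forall>X \<subseteq> underS r b. |X| <o kappa \<longrightarrow> (\<exists>y. lt r y b \<and> (\<forall>x\<in>X. lt r x y))"
proof -
  interpret well_order_rel r using r(1) by (simp add: well_order_rel_def card_order_on_def)
  interpret K: well_order_rel kappa using k(1) by (simp add: well_order_rel_def card_order_on_def)
  \<comment> \<open>The guard on \<open>i\<close> makes \<open>P\<close> trivial outside
    \<open>Field kappa\<close>, since the recursion runs over the whole type.\<close>
  define P where "P f i v \<longleftrightarrow> (i \<in> Field kappa \<longrightarrow> v \<in> Field r \<and> lt r g v \<and>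
      (\<forall>j\<in>underS kappa i. lt r (f j) v \<and> lt r (h (f j)) v))" for f :: "'b \<Rightarrow> 'a" and i v
  have "\<exists>f. \<forall>i. P f i (f i)"
  proof (rule dependent_wf_choice[OF wo_rel.WF[OF K.wo_rel]])
    fix f g :: "'b \<Rightarrow> 'a" and i v
    assume "\<And>z. (z, i) \<in> kappa - Id \<Longrightarrow> f z = g z"
    then show "P f i v = P g i v" by (auto simp: P_def underS_def)
  next
    fix i and f :: "'b \<Rightarrow> 'a"
    assume IH: "\<And>y. (y, i) \<in> kappa - Id \<Longrightarrow> P f y (f y)"
    show "\<exists>v. P f i v"
    proof (cases "i \<in> Field kappa")
      case True
      let ?U = "underS kappa i"
      \<comment> \<open>Initial segments of \<open>kappa\<close> are smaller than \<open>r\<close>,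
        so regularity of \<open>r\<close> bounds all earlier values together with their images under
        \<open>h\<close>.\<close>
      have U: "|?U| <o r"
        using card_of_underS[OF k(1) True] kr by (rule ordLess_transitive)
      have "j \<in> ?U \<Longrightarrow> f j \<in> Field r" for j
        using IH[of j] by (auto simp: P_def underS_def Field_def)
      then have sub: "insert g (f ` ?U \<union> (h \<circ> f) ` ?U) \<subseteq> Field r"
        using h g by auto
      have im: "|f ` ?U| <o r" "|(h \<circ> f) ` ?U| <o r"
        using card_of_image U by (metis ordLeq_ordLess_trans)+
      have "|{g}| <o r" 

        using finite_ordLess_infinite[OF card_of_Well_order well_order, of "{g}"] r(3)
        by (simp add: Field_card_of)
      then have "|insert g (f ` ?U \<union> (h \<circ> f) ` ?U)| <o r"
        using card_of_Un_ordLess_infinite_Field[OF r(3,1)] im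
        by (metis insert_is_Un)
      then obtain v where "v \<in> Field r"
        "\<forall>x\<in>insert g (f ` ?U \<union> (h \<circ> f) ` ?U). lt r x v"
        by (rule regularCard_strict_bound[OF r sub])
      then show ?thesis unfolding P_def by (intro exI[of _ v]) auto
    qed (simp add: P_def)
  qed
  then obtain f where P: "\<And>i. P f i (f i)" by blast
  have f: "f i \<in> Field r \<and> lt r g (f i)" if "i \<in> Field kappa" for i
    using P[of i] that by (simp add: P_def)
  have f_step: "lt r (f j) (f i) \<and> lt r (h (f j)) (f i)" if "lt kappa j i" for i j
    using P[of i] that K.lt_Field(2)[OF that] by (simp add: P_def K.underS_iff_lt[symmetric])
  have "|f ` Field kappa| <o r"
    using card_of_image[of f "Field kappa"] card_of_Field_ordIso[OF k(1)] kr
    by (meson ordIso_ordLess_trans ordLeq_ordLess_trans)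
  then obtain b0 where "b0 \<in> Field r" "\<forall>x\<in>f ` Field kappa. lt r x b0"
    using regularCard_strict_bound[OF r, of "f ` Field kappa"] f by auto
  then obtain b where b: "b \<in> Field r" "\<forall>x\<in>f ` Field kappa. lt r x b"
    "\<And>y. lt r y b \<Longrightarrow> \<exists>x\<in>f ` Field kappa. (y, x) \<in> r"
    using ex_least_strict_upper_bound by metis
  have f_above: "\<exists>j. lt kappa i j" if "i \<in> Field kappa" for i
    using infinite_Card_order_limit[OF k(1,3) that] by (auto simp: lt_def)
  show ?thesis
  proof (rule that; (intro allI impI)?)
    obtain i where "i \<in> Field kappa" using k(3) by (metis finite.emptyI ex_in_conv)
    then show "lt r g b" using f b(2) lt_trans by blast
  next
    fix x assume "lt r x b"
    then obtain i where i: "i \<in> Field kappa" "(x, f i) \<in> r" using b(3) by blast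
    then obtain j where "lt kappa i j" using f_above by blast
    then have "lt r (h (f i)) b" using f_step b(2) lt_trans K.lt_Field by (metis imageI)
    then show "\<exists>y. (x, y) \<in> r \<and> lt r y b \<and> lt r (h y) b" using i b(2) by blast
  next
    fix X assume X: "X \<subseteq> underS r b" "|X| <o kappa"
    \<comment> \<open>Each element of \<open>X\<close> lies below some value of \<open>f\<close>.
      Regularity of \<open>kappa\<close> bounds the chosen indices, so a single value dominates
      \<open>X\<close>.\<close>
    have "\<exists>i. i \<in> Field kappa \<and> (x, f i) \<in> r" if "x \<in> X" for x
      using X(1) that b(3)[of x] underS_iff_lt by blast
    then obtain p where p: "\<And>x. x \<in> X \<Longrightarrow> p x \<in> Field kappa \<and> (x, f (p x)) \<in> r" by metis
    have "|p ` X| <o kappa" using card_of_image X(2) by (rule ordLeq_ordLess_trans)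
    moreover have "p ` X \<subseteq> Field kappa" using p by auto
    ultimately obtain i where i: "i \<in> Field kappa" "\<forall>j\<in>p ` X. lt kappa j i"
      using regularCard_strict_bound[OF k] by metis
    have "lt r x (f i)" if "x \<in> X" for x
      using le_lt_trans[of x "f (p x)" "f i"] p[OF that] f_step[of "p x" i] i(2) that by blast
    moreover have "lt r (f i) b" using b(2) i(1) by blast
    ultimately show "\<exists>y. lt r y b \<and> (\<forall>x\<in>X. lt r x y)" by blast
  qed
qed

section \<open>Pressing down to a single ordinal\<close>

text \<open>Fodor's argument: were every candidate set disjoint from a club \<open>E \<alpha>\<close>, a point closed
  under taking the next element of each \<open>E \<alpha>\<close> would lie in their diagonal intersection.\<close>

lemma ex_stationary_all_acc:
  fixes r :: "'a rel" and kappa :: "'b rel"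
  assumes r: "Card_order r" "regularCard r" "infinite (Field r)"
    and k: "Card_order kappa" "regularCard kappa" "\<not> countable (Field kappa)"
    and kr: "kappa <o r"
    and clubs: "\<And>b C. b \<in> Field r \<Longrightarrow> C \<in> \<C> b \<Longrightarrow> club_in r b C"
    and width: "\<And>b. b \<in> Field r \<Longrightarrow> |\<C> b| <o kappa"
    and g: "g \<in> Field r"
  obtains a where "lt r g a" "stationary r {b \<in> Field r. \<forall>C\<in>\<C> b. a \<in> acc r C}"
proof (rule ccontr)
  assume no: "\<not> thesis"
  note thesisI = that
  interpret well_order_rel r using r(1) by (simp add: well_order_rel_def card_order_on_def)
  have k_inf: "infinite (Field kappa)" using k(3) countable_finite by blast
  have "\<exists>E. club r E \<and> {b \<in> Field r. \<forall>C\<in>\<C> b. a \<in> acc r C} \<inter> E = {}" if "lt r g a" for a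
    using no thesisI[OF that] unfolding stationary_def by blast
  then have "\<forall>a. \<exists>E. lt r g a \<longrightarrow> club r E \<and> {b \<in> Field r. \<forall>C\<in>\<C> b. a \<in> acc r C} \<inter> E = {}"
    by blast
  from choice[OF this] obtain E where E: "\<And>a. lt r g a \<Longrightarrow>
      club r (E a) \<and> {b \<in> Field r. \<forall>C\<in>\<C> b. a \<in> acc r C} \<inter> E a = {}"
    by blast
  \<comment> \<open>One \<open>y\<close> can serve all \<open>a\<close> up to \<open>x\<close> at
    once: they form a set smaller than \<open>r\<close>, so the chosen next elements of the clubs
    \<open>E a\<close> are bounded.\<close>
  have "\<exists>y. y \<in> Field r \<and> (\<forall>a. lt r g a \<longrightarrow> (a, x) \<in> r \<longrightarrow> (\<exists>e\<in>E a. lt r x e \<and> lt r e y))"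
    if x: "x \<in> Field r" for x
  proof -
    let ?A = "{a. lt r g a \<and> (a, x) \<in> r}"
    have "\<exists>e\<in>E a. lt r x e" if "lt r g a" for a
    proof -
      obtain x' where "x' \<in> Field r" "lt r x x'"
        using infinite_Card_order_limit[OF r(1,3) x] by (auto simp: lt_def)
      then show ?thesis using E[OF that] lt_le_trans unfolding club_def by blast
    qed
    then obtain e where e: "\<And>a. a \<in> ?A \<Longrightarrow> e a \<in> E a \<and> lt r x (e a)"
      by (metis (lifting) mem_Collect_eq)
    obtain x' where x': "lt r x x'"
      using infinite_Card_order_limit[OF r(1,3) x] by (auto simp: lt_def)
    have "?A \<subseteq> underS r x'" using le_lt_trans x' by (auto simp: underS_iff_lt)
    then have "|?A| <o r"
      using card_of_underS[OF r(1) lt_Field(2)[OF x']] card_of_mono1 ordLeq_ordLess_trans by blast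
    then have "|e ` ?A| <o r" using card_of_image by (blast intro: ordLeq_ordLess_trans)
    moreover have "e ` ?A \<subseteq> Field r" using e lt_Field by blast
    ultimately obtain y where "y \<in> Field r" "\<And>z. z \<in> e ` ?A \<Longrightarrow> lt r z y"
      using regularCard_strict_bound[OF r] by metis
    then show ?thesis using e by blast
  qed
  then obtain h where h: "\<And>x. x \<in> Field r \<Longrightarrow> h x \<in> Field r"
    "\<And>x a. x \<in> Field r \<Longrightarrow> lt r g a \<Longrightarrow> (a, x) \<in> r \<Longrightarrow> \<exists>e\<in>E a. lt r x e \<and> lt r e (h x)"
    by metis
  obtain b where b: "lt r g b"
    "\<forall>x. lt r x b \<longrightarrow> (\<exists>y. (x, y) \<in> r \<and> lt r y b \<and> lt r (h y) b)"
    "\<forall>X \<subseteq> underS r b. |X| <o kappa \<longrightarrow> (\<exists>y. lt r y b \<and> (\<forall>x\<in>X. lt r x y))"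
    by (rule closure_point_of_large_cofinality[of r kappa h g, OF r k(1,2) k_inf kr h(1) g])
  have bF: "b \<in> Field r" using b(1) lt_Field by blast
  \<comment> \<open>As \<open>kappa\<close> is uncountable, boundedness of sets smaller than
    \<open>kappa\<close> gives \<open>b\<close> uncountable cofinality.\<close>
  have countable_less: "|X| <o kappa" if "countable X" for X :: "'a set"
  proof -
    have "\<not> |Field kappa| \<le>o |X|"
      using that k(3) by (metis card_of_ordLeq countable_image countable_subset image_subset_iff
          inj_on_iff_surj countable_image_inj_on)
    then have "|X| <o |Field kappa|"
      by (simp add: not_ordLeq_iff_ordLess card_of_Well_order)
    then show ?thesis using card_of_Field_ordIso[OF k(1)] by (rule ordLess_ordIso_trans)
  qed
  have ub: "uncountable_cof r b"
    unfolding uncountable_cof_def using bF b(3) countable_less by (metis underS_iff_lt)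
  have "\<exists>y. lt r y b \<and> (\<forall>C\<in>\<C> b. lt r (f C) y)"
    if "\<And>C. C \<in> \<C> b \<Longrightarrow> lt r (f C) b" for f
  proof -
    have "|f ` \<C> b| <o kappa" using card_of_image width[OF bF] by (rule ordLeq_ordLess_trans)
    moreover have "f ` \<C> b \<subseteq> underS r b" using that by (auto simp: underS_iff_lt)
    ultimately show ?thesis using b(3) by (metis imageI)
  qed
  then obtain a where a: "lt r g a" "lt r a b" "\<And>C. C \<in> \<C> b \<Longrightarrow> a \<in> acc r C"
    using common_acc_point[of b "\<C> b" g, OF ub clubs[OF bF] _ b(1)] by metis
  have "\<exists>d\<in>E a. lt r x d \<and> lt r d b" if x: "lt r x b" for x
  proof -
    \<comment> \<open>Take \<open>z\<close> as the larger of \<open>x\<close> and \<open>a\<close>,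
      because \<open>h\<close> handles \<open>E a\<close> only from \<open>a\<close>
      onwards.\<close>
    obtain z where z: "lt r z b" "(x, z) \<in> r" "(a, z) \<in> r"
      using x a(2) not_lt_iff_le[of x a] lt_Field le_refl unfolding lt_def by metis
    obtain y where y: "(z, y) \<in> r" "lt r y b" "lt r (h y) b" using b(2) z(1) by blast
    have "(a, y) \<in> r" using z(3) y(1) TRANS unfolding trans_def by blast
    then obtain e where "e \<in> E a" "lt r y e" "lt r e (h y)"
      using h(2)[OF _ a(1), of y] lt_Field(1)[OF y(2)] by blast
    moreover have "(x, y) \<in> r" using z(2) y(1) TRANS unfolding trans_def by blast
    ultimately show ?thesis using y(3) le_lt_trans lt_trans by blast
  qed
  moreover have "\<exists>e\<in>E a. (b, e) \<in> r" using E[OF a(1)] bF unfolding club_def by blast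
  ultimately have "b \<in> acc r (E a)" using accI a(2) by metis
  \<comment> \<open>Now \<open>b\<close> lies in \<open>E a\<close> and also in the candidate set
    for \<open>a\<close>, which \<open>E a\<close> was chosen to avoid.\<close>
  then have "b \<in> E a" using E[OF a(1)] bF unfolding club_def by blast
  then show False using E[OF a(1)] a(3) bF by blast
qed

section \<open>Two stationary sets without a common reflection point\<close>

theorem theorem2p12:
  fixes r :: "'a rel" and kappa :: "'b rel" and \<C> :: "'a \<Rightarrow> 'a set set"
  assumes "Card_order r" and "regularCard r" and "\<not> countable (Field r)"
    and "Card_order kappa" and "regularCard kappa" and "\<not> countable (Field kappa)"
    and "(kappa, r) \<in> ordLess"
    and "square_seq r kappa \<C>" and "\<not> full r \<C>"
  shows "\<exists>S T. stationary r S \<and> stationary r T \<and>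
           \<not> (\<exists>a\<in>Field r. reflects_at r S a \<and> reflects_at r T a)"
proof -
  interpret well_order_rel r using assms(1) by (simp add: well_order_rel_def card_order_on_def)
  have r_inf: "infinite (Field r)" using assms(3) countable_finite by blast
  have nonempty: "\<C> b \<noteq> {}" and width: "|\<C> b| <o kappa"
    and clubs: "\<And>C. C \<in> \<C> b \<Longrightarrow> club_in r b C"
    and coherent: "\<And>C a. C \<in> \<C> b \<Longrightarrow> a \<in> acc r C \<Longrightarrow> C \<inter> underS r a \<in> \<C> a"
    if "b \<in> Field r" for b
    using assms(8) that by (simp_all add: square_seq_def coherent_seq_def)
  obtain g where g: "g \<in> Field r" "\<And>a. lt r g a \<Longrightarrow> a \<notin> A_set r \<C>"
    using assms(9) unfolding full_def by blast
  obtain a where a: "lt r g a" and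
    T: "stationary r {b \<in> Field r. \<forall>C\<in>\<C> b. a \<in> acc r C}" (is "stationary r ?T")
    by (rule ex_stationary_all_acc[of r kappa \<C> g, OF assms(1,2) r_inf assms(4-7) clubs width g(1)])
  have S: "stationary r {b \<in> Field r. \<forall>C\<in>\<C> b. a \<notin> acc r C}" (is "stationary r ?S")
    unfolding stationary_def
  proof (intro conjI allI impI)
    fix D assume D: "club r D"
    \<comment> \<open>Since \<open>a\<close> is outside \<open>A_set r \<C>\<close>, the club
      \<open>D\<close> cannot witness membership, so it has a point in the first set.\<close>
    then obtain b where "b \<in> D" "a \<notin> (\<Union>C\<in>\<C> b. acc r C)"
      using g(2)[OF a] lt_Field(2)[OF a] unfolding A_set_def by blast
    moreover have "D \<subseteq> Field r" using D by (simp add: club_def)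
    ultimately show "?S \<inter> D \<noteq> {}" by blast
  qed blast
  have False if d: "d \<in> Field r" and reflS: "reflects_at r ?S d" and reflT: "reflects_at r ?T d" for d
  proof -
    obtain C where C: "C \<in> \<C> d" using nonempty[OF d] by blast
    have ud: "uncountable_cof r d" using reflS by (simp add: reflects_at_def)
    \<comment> \<open>Any \<open>z\<close> below \<open>d\<close> will do: it allows a first use of
      the club of limits of \<open>C\<close> before \<open>a\<close> is known to lie below
      \<open>d\<close>.\<close>
    obtain z where z: "lt r z d"
      using ud unfolding uncountable_cof_def by (metis countable_empty empty_subsetI underS_iff_lt)
    obtain t where t: "t \<in> ?T" "t \<in> acc r C" "lt r t d"
      using club_in_acc_above[OF ud clubs[OF d C] z] reflT
      unfolding reflects_at_def stationary_in_def by blast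
    \<comment> \<open>By coherence the truncation belongs to \<open>\<C> t\<close>. A limit of a
      subset of \<open>t\<close> lies below \<open>t\<close>, which places \<open>a\<close> below
      \<open>d\<close>.\<close>
    then have "a \<in> acc r (C \<inter> underS r t)" using coherent[OF d C] by blast
    then have "lt r a t" using le_lt_trans by (auto simp: acc_def underS_iff_lt)
    then have ad: "lt r a d" using t(3) lt_trans by blast
    define E where "E = {b \<in> acc r C. lt r a b \<and> lt r b d}"
    have "club_in r d E"
      unfolding E_def using club_in_acc_above[OF ud clubs[OF d C] ad] .
    then obtain s t where s: "s \<in> ?S" "s \<in> E" and t: "t \<in> ?T" "t \<in> E"
      using reflS reflT unfolding reflects_at_def stationary_in_def by blast
    \<comment> \<open>For every \<open>b\<close> in \<open>E\<close>, a member of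
      \<open>\<C> b\<close> agrees with \<open>C\<close> on whether \<open>a\<close> is a limit;
      \<open>s\<close> forces the answer no and \<open>t\<close> the answer yes.\<close>
    have "C \<inter> underS r b \<in> \<C> b \<and> (a \<in> acc r (C \<inter> underS r b) \<longleftrightarrow> a \<in> acc r C)" if "b \<in> E" for b
    proof -
      from that have "b \<in> acc r C" "lt r a b" by (simp_all add: E_def)
      then show ?thesis using coherent[OF d C] acc_Int_underS by metis
    qed
    then show False using s t by blast
  qed
  then show ?thesis using S T by blast
qed

end
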